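(* Let $G$ be a non-abelian capable finite group and let $p$ be the smallest prime number dividing the order of $G$. Then for all $n\ge 1$, $D^{\wedge}_n(G)\leq \frac{1}{p^n}$.
   Context: A group $G$ is capable if $G\cong E/Z(E)$ for some group $E$. For a group $G$ write ${}^hg=hgh^{-1}$. The tensor square $G\otimes G$ is the group generated by symbols $g\otimes h$ ($g,h\in G$) subject to $gk\otimes h=({}^gk\otimes {}^gh)(g\otimes h)$ and $g\otimes hk=(g\otimes h)({}^hg\otimes {}^hk)$ for all $g,h,k\in G$. The exterior square $G\wedge G$ is the quotient of $G\otimes G$ obtained by imposing the additional relations $g\otimes g=1$ for all $g\in G$; the image of $x\otimes y$ is denoted $x\wedge y$. For a finite group $G$ and an integer $n\ge 0$, the multiple exterior degree is $$D^{\wedge}_n(G)=\frac{|\{(x_1,\dots,x_{n+1})\in G^{n+1}: x_i\wedge x_j=1 \text{ in } G\wedge G \text{ for all } 1\le i,j\le n+1\}|}{|G|^{n+1}}.$$ *)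

theory Defs
  imports Complex_Main "HOL-Computational_Algebra.Primes" "HOL-Algebra.Coset"
begin

section \<open>Capable groups\<close>

definition center :: "('a, 'b) monoid_scheme \<Rightarrow> 'a set" where
  "center G = {z \<in> carrier G. \<forall>g \<in> carrier G. z \<otimes>\<^bsub>G\<^esub> g = g \<otimes>\<^bsub>G\<^esub> z}"

text \<open>HOL cannot quantify existentially over types, so the type of the elements of the covering
  group \<open>E\<close> is a parameter. In a theorem with the hypothesis \<open>capable TYPE('e) G\<close>, where \<open>'e\<close> is a
  type variable not occurring elsewhere, \<open>E\<close> thus ranges over groups of every type.\<close>

definition capable :: "'e itself \<Rightarrow> ('a, 'b) monoid_scheme \<Rightarrow> bool" where
  "capable _ G \<longleftrightarrow> (\<exists>E :: 'e monoid. group E \<and> G \<cong> E Mod center E)"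


section \<open>Groups given by generators and relations\<close>

text \<open>The letter \<open>(x, True)\<close> stands for the generator \<open>x\<close> and \<open>(x, False)\<close> for its formal inverse.\<close>

type_synonym 'x word = "('x \<times> bool) list"

abbreviation words :: "'x set \<Rightarrow> 'x word set" where
  "words S \<equiv> lists (S \<times> UNIV)"

text \<open>A pair \<open>(u, v) \<in> R\<close> is the relation \<open>u = v\<close>.\<close>

inductive_set presentation_rel :: "'x set \<Rightarrow> ('x word \<times> 'x word) set \<Rightarrow> ('x word \<times> 'x word) set"
  for S :: "'x set" and R :: "('x word \<times> 'x word) set"
where
  refl: "w \<in> words S \<Longrightarrow> (w, w) \<in> presentation_rel S R"
| sym: "(u, v) \<in> presentation_rel S R \<Longrightarrow> (v, u) \<in> presentation_rel S R"
| trans: "(u, v) \<in> presentation_rel S R \<Longrightarrow> (v, w) \<in> presentation_rel S R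
    \<Longrightarrow> (u, w) \<in> presentation_rel S R"
| append: "(u, u') \<in> presentation_rel S R \<Longrightarrow> (v, v') \<in> presentation_rel S R
    \<Longrightarrow> (u @ v, u' @ v') \<in> presentation_rel S R"
| cancel: "x \<in> S \<Longrightarrow> ([(x, e), (x, \<not> e)], []) \<in> presentation_rel S R"
| relation: "(u, v) \<in> R \<Longrightarrow> u \<in> words S \<Longrightarrow> v \<in> words S \<Longrightarrow> (u, v) \<in> presentation_rel S R"

definition presented_group :: "'x set \<Rightarrow> ('x word \<times> 'x word) set \<Rightarrow> 'x word set monoid" where
  "presented_group S R =
     \<lparr>carrier = words S // presentation_rel S R,
      monoid.mult = (\<lambda>A B. \<Union>u \<in> A. \<Union>v \<in> B. presentation_rel S R `` {u @ v}),
      one = presentation_rel S R `` {[]}\<rparr>"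

definition presented_gen :: "'x set \<Rightarrow> ('x word \<times> 'x word) set \<Rightarrow> 'x \<Rightarrow> 'x word set" where
  "presented_gen S R x = presentation_rel S R `` {[(x, True)]}"

lemma presentation_rel_words:
  assumes "(u, v) \<in> presentation_rel S R"
  shows "u \<in> words S" "v \<in> words S"
  using assms by (induction rule: presentation_rel.induct) auto

lemma equiv_presentation_rel: "equiv (words S) (presentation_rel S R)"
  by (rule equivI)
    (auto intro!: refl_onI symI transI intro: presentation_rel.intros dest: presentation_rel_words)

lemma presented_group_mult:
  assumes "u \<in> words S" "v \<in> words S"
  shows "(presentation_rel S R `` {u}) \<otimes>\<^bsub>presented_group S R\<^esub> (presentation_rel S R `` {v})
       = presentation_rel S R `` {u @ v}"
proof -
  have "congruent2 (presentation_rel S R) (presentation_rel S R)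
      (\<lambda>u v. presentation_rel S R `` {u @ v})"
    by (rule congruent2I', rule equiv_class_eq[OF equiv_presentation_rel],
        rule presentation_rel.append)
  from UN_equiv_class2[OF equiv_presentation_rel equiv_presentation_rel this assms]
  show ?thesis by (simp add: presented_group_def)
qed

lemma presentation_rel_left_inverse:
  assumes "w \<in> words S"
  shows "\<exists>w' \<in> words S. (w' @ w, []) \<in> presentation_rel S R"
  using assms
proof (induction w)
  case Nil
  show ?case by (auto intro!: presentation_rel.refl bexI[of _ "[]"])
next
  case (Cons a w)
  then obtain w' where w': "w' \<in> words S" "(w' @ w, []) \<in> presentation_rel S R"
    by auto
  obtain x e where a: "a = (x, e)" and x: "x \<in> S"
    using Cons.hyps(1) by (cases a) auto
  have w: "w \<in> words S" by fact
  have "([(x, \<not> e), a], []) \<in> presentation_rel S R"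
    using presentation_rel.cancel[OF x, of "\<not> e" R] a by simp
  from presentation_rel.append[OF this presentation_rel.refl[OF w]]
  have "([(x, \<not> e)] @ a # w, w) \<in> presentation_rel S R" by simp
  from presentation_rel.append[OF presentation_rel.refl[OF w'(1)] this]
  have "(w' @ [(x, \<not> e)] @ a # w, w' @ w) \<in> presentation_rel S R" .
  from presentation_rel.trans[OF this w'(2)]
  show ?case using w'(1) x
    by (intro bexI[of _ "w' @ [(x, \<not> e)]"]) auto
qed

lemma group_presented_group: "group (presented_group S R)"
proof -
  have carr: "carrier (presented_group S R) = (\<lambda>u. presentation_rel S R `` {u}) ` words S"
    by (auto simp: presented_group_def quotient_def)
  have one: "\<one>\<^bsub>presented_group S R\<^esub> = presentation_rel S R `` {[]}"
    by (simp add: presented_group_def)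
  show ?thesis
  proof (rule groupI)
    fix X assume "X \<in> carrier (presented_group S R)"
    then obtain u where u: "u \<in> words S" "X = presentation_rel S R `` {u}"
      by (auto simp: carr)
    then obtain v where v: "v \<in> words S" "(v @ u, []) \<in> presentation_rel S R"
      using presentation_rel_left_inverse by blast
    then show "\<exists>Y \<in> carrier (presented_group S R).
        Y \<otimes>\<^bsub>presented_group S R\<^esub> X = \<one>\<^bsub>presented_group S R\<^esub>"
      using u by (intro bexI[of _ "presentation_rel S R `` {v}"])
        (auto simp: presented_group_mult one carr
          intro!: equiv_class_eq[OF equiv_presentation_rel])
  qed (auto simp: carr one presented_group_mult in_listsI)
qed

definition normal_closure :: "('a, 'b) monoid_scheme \<Rightarrow> 'a set \<Rightarrow> 'a set" where
  "normal_closure G A = \<Inter> {N. N \<lhd> G \<and> A \<subseteq> N}"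

lemma normal_normal_closure:
  assumes "group G" "A \<subseteq> carrier G"
  shows "normal_closure G A \<lhd> G"
proof -
  interpret group G by fact
  have *: "carrier G \<in> {N. N \<lhd> G \<and> A \<subseteq> N}"
    using assms(2) subgroup_self by (auto intro!: normal_invI)
  have "subgroup (normal_closure G A) G"
    unfolding normal_closure_def using *
    by (intro subgroups_Inter) (blast intro: normal_imp_subgroup)+
  then show ?thesis
    by (rule normal_invI) (auto simp: normal_closure_def normal_inv_iff)
qed


section \<open>Tensor square and exterior square\<close>

definition conjugate :: "('a, 'b) monoid_scheme \<Rightarrow> 'a \<Rightarrow> 'a \<Rightarrow> 'a" where
  "conjugate G h g = h \<otimes>\<^bsub>G\<^esub> g \<otimes>\<^bsub>G\<^esub> inv\<^bsub>G\<^esub> h"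

definition tensor_relations ::
  "('a, 'b) monoid_scheme \<Rightarrow> (('a \<times> 'a) word \<times> ('a \<times> 'a) word) set" where
  "tensor_relations G =
     {([((g \<otimes>\<^bsub>G\<^esub> k, h), True)],
       [((conjugate G g k, conjugate G g h), True), ((g, h), True)]) | g h k.
         g \<in> carrier G \<and> h \<in> carrier G \<and> k \<in> carrier G} \<union>
     {([((g, h \<otimes>\<^bsub>G\<^esub> k), True)],
       [((g, h), True), ((conjugate G h g, conjugate G h k), True)]) | g h k.
         g \<in> carrier G \<and> h \<in> carrier G \<and> k \<in> carrier G}"

definition tensor_square :: "('a, 'b) monoid_scheme \<Rightarrow> ('a \<times> 'a) word set monoid" where
  "tensor_square G = presented_group (carrier G \<times> carrier G) (tensor_relations G)"

definition tensor :: "('a, 'b) monoid_scheme \<Rightarrow> 'a \<Rightarrow> 'a \<Rightarrow> ('a \<times> 'a) word set" where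
  "tensor G g h = presented_gen (carrier G \<times> carrier G) (tensor_relations G) (g, h)"

definition exterior_kernel :: "('a, 'b) monoid_scheme \<Rightarrow> ('a \<times> 'a) word set set" where
  "exterior_kernel G = normal_closure (tensor_square G) {tensor G g g | g. g \<in> carrier G}"

definition exterior_square :: "('a, 'b) monoid_scheme \<Rightarrow> ('a \<times> 'a) word set set monoid" where
  "exterior_square G = tensor_square G Mod exterior_kernel G"

lemma group_exterior_square: "group (exterior_square G)"
  unfolding exterior_square_def exterior_kernel_def
proof (intro normal.factorgroup_is_group normal_normal_closure)
  show "group (tensor_square G)"
    by (simp add: tensor_square_def group_presented_group)
  show "{tensor G g g | g. g \<in> carrier G} \<subseteq> carrier (tensor_square G)"
    by (auto simp: tensor_def presented_gen_def tensor_square_def presented_group_def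
        intro!: quotientI)
qed

definition wedge :: "('a, 'b) monoid_scheme \<Rightarrow> 'a \<Rightarrow> 'a \<Rightarrow> ('a \<times> 'a) word set set" where
  "wedge G x y = exterior_kernel G #>\<^bsub>tensor_square G\<^esub> tensor G x y"


section \<open>Multiple exterior degree\<close>

definition exterior_degree :: "nat \<Rightarrow> ('a, 'b) monoid_scheme \<Rightarrow> real" where
  "exterior_degree n G =
     real (card {x \<in> {1..n+1} \<rightarrow>\<^sub>E carrier G.
       \<forall>i \<in> {1..n+1}. \<forall>j \<in> {1..n+1}. wedge G (x i) (x j) = \<one>\<^bsub>exterior_square G\<^esub>})
     / real (order G) ^ (n + 1)"

end

theory Submission
  imports Defs "HOL-Algebra.Elementary_Groups"
begin

text \<open>
  Write \<open>G \<cong> E / Z(E)\<close>, with projection \<open>\<pi>: E \<rightarrow> G\<close>. A commutator in \<open>E\<close> is unchanged when its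
  entries are multiplied by central elements, so it depends only on their images in \<open>G\<close>. The
  resulting map \<open>(x, y) \<mapsto> [a, b]\<close>, where \<open>\<pi> a = x\<close> and \<open>\<pi> b = y\<close>, satisfies the defining relations
  of the exterior square. Hence \<open>x \<and> y = 1\<close> forces all lifts of \<open>x\<close> and \<open>y\<close> to commute
  (\<open>wedge_eq_one_imp_pairing_eq_one\<close>), and it is enough to count tuples in \<open>G\<close> whose lifts commute
  pairwise.

  Let \<open>C x\<close> be the subgroup of those \<open>y \<in> G\<close> whose lifts commute with the lifts of \<open>x\<close>. Since the
  kernel of \<open>\<pi>\<close> is the whole centre of \<open>E\<close>, the subgroup \<open>C x\<close> is proper for every \<open>x \<noteq> 1\<close>, so its
  index is then at least \<open>p\<close>. The term \<open>x = 1\<close> alone pushes the average of \<open>|C x| / |G|\<close> up, so this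
  does not give the bound \<open>1 / p\<close> for pairs; it has to be compensated by elements for which the
  index is larger than \<open>p\<close>. Let \<open>A\<close> be the set of elements for which the index is exactly \<open>p\<close>. A
  subgroup whose index is the smallest prime divisor of \<open>|G|\<close> is normal with abelian quotient, and so
  contains every commutator of \<open>G\<close>. If \<open>A\<close> generated \<open>G\<close>, then by symmetry \<open>C c = G\<close>, that is
  \<open>c = 1\<close>, for every commutator \<open>c\<close>, and \<open>G\<close> would be abelian. So \<open>A\<close> generates a proper subgroup, and
  \<open>p (|A| + 1) \<le> |G|\<close> (\<open>card_large_le\<close>). With \<open>|G| \<ge> p (p + 1)\<close> (\<open>order_ge\<close>) there are enough
  elements outside \<open>A\<close> to obtain \<open>p (\<Sum>x. |C x|) \<le> |G|\<^sup>2\<close> (\<open>sum_card_C_le\<close>), which is the case of pairs.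

  Longer tuples are handled by induction on their length, splitting according to the last entry
  \<open>y\<close>. If \<open>y = 1\<close>, the other entries form an arbitrary shorter commuting tuple; otherwise they all
  lie in \<open>C y\<close>, and \<open>p |C y| \<le> |G|\<close> reduces the estimate to that for pairs once more.
\<close>

section \<open>Subgroups of smallest prime index\<close>

lemma (in group) prime_order_imp_comm_group:
  assumes "prime (order G)"
  shows "comm_group G"
proof -
  have "order G > 1" using assms prime_gt_1_nat by blast
  then have "carrier G \<noteq> {\<one>}"
    unfolding order_def by auto
  then obtain x where x: "x \<in> carrier G" "x \<noteq> \<one>"
    using one_closed by blast
  have sub: "subgroup (generate G {x}) G"
    using x by (simp add: generate_is_subgroup)
  then have "card (generate G {x}) dvd order G"
    using lagrange by (metis dvd_triv_right)
  moreover have "card (generate G {x}) \<noteq> 1"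
    using x by (metis card_1_singletonE generate.incl generate.one insertI1 singletonD)
  ultimately have "card (generate G {x}) = order G"
    using assms prime_nat_iff by blast
  moreover have "finite (carrier G)"
    using \<open>order G > 1\<close> order_gt_0_iff_finite by simp
  ultimately have "generate G {x} = carrier G"
    using sub card_subset_eq subgroup.subset unfolding order_def by metis
  then have "cyclic_group G"
    unfolding cyclic_group using x(1) by (auto simp: generate_pow intro!: bexI[of _ x])
  then show ?thesis by (rule cyclic_imp_abelian_group)
qed

locale smallest_prime_group = group G for G (structure) +
  fixes p :: nat
  assumes finite_carrier: "finite (carrier G)"
    and prime_p: "prime p"
    and p_dvd_order: "p dvd order G"
    and p_least: "\<And>q. prime q \<Longrightarrow> q dvd order G \<Longrightarrow> p \<le> q"
begin

lemma p_ge_2: "2 \<le> p"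
  using prime_p prime_ge_2_nat by blast

lemma order_pos: "0 < order G"
  using finite_carrier order_gt_0_iff_finite by blast

lemma subgroup_finite: "subgroup H G \<Longrightarrow> finite H"
  using finite_carrier finite_subset subgroup.subset by blast

lemma p_le_divisor:
  assumes "d dvd order G" "d \<noteq> 1"
  shows "p \<le> d"
proof -
  obtain q where q: "prime q" "q dvd d"
    using prime_factor_nat assms(2) by blast
  have "0 < d"
    using assms(1) order_pos by (metis dvd_0_left_iff not_gr_zero)
  then have "q \<le> d"
    using q(2) dvd_imp_le by blast
  then show ?thesis
    using p_least[OF q(1)] q(2) assms(1) dvd_trans le_trans by blast
qed

lemma card_subgroup_ge:
  assumes "subgroup H G" "H \<noteq> {\<one>}"
  shows "p \<le> card H"
proof (rule p_le_divisor)
  show "card H dvd order G"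
    using lagrange[OF assms(1)] by (metis dvd_triv_right)
  show "card H \<noteq> 1"
    using assms subgroup.one_closed by (metis card_1_singletonE singletonD)
qed

lemma proper_quotient_ge:
  assumes "a * b dvd order G" "a * b \<noteq> b"
  shows "p * b \<le> a * b"
  using p_le_divisor[of a] assms by (metis dvd_mult_left mult_1 mult_le_mono1)

lemma card_proper_subgroup_le:
  assumes "subgroup H G" "H \<noteq> carrier G"
  shows "p * card H \<le> order G"
proof -
  have "card H \<noteq> order G"
    using assms finite_carrier unfolding order_def
    by (metis card_subset_eq subgroup.subset)
  then show ?thesis
    using proper_quotient_ge[of "card (rcosets H)" "card H"] lagrange[OF assms(1)] by simp
qed

text \<open>The multiplication map \<open>H \<times> K \<rightarrow> H K\<close> has fibres of size at most \<open>|H \<inter> K|\<close>: two factorisations of the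
  same element differ by an element of \<open>H \<inter> K\<close>.\<close>

lemma card_mult_le_card_set_mult:
  assumes H: "subgroup H G" and K: "subgroup K G"
  shows "card H * card K \<le> card (H <#> K) * card (H \<inter> K)"
proof -
  have HG: "h \<in> carrier G" if "h \<in> H" for h
    using that H subgroup.mem_carrier by metis
  have KG: "k \<in> carrier G" if "k \<in> K" for k
    using that K subgroup.mem_carrier by metis
  let ?F = "\<lambda>y. {(h, k) \<in> H \<times> K. h \<otimes> k = y}"
  have fin: "finite H" "finite K"
    using H K subgroup_finite by auto
  have fib: "card (?F y) \<le> card (H \<inter> K)" for y
  proof (cases "?F y = {}")
    case False
    then obtain h0 k0 where hk0: "h0 \<in> H" "k0 \<in> K" "h0 \<otimes> k0 = y"
      by auto
    have eq: "inv h0 \<otimes> h = k0 \<otimes> inv k" if "h \<in> H" "k \<in> K" "h \<otimes> k = y" for h k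
    proof -
      have "h0 \<otimes> k0 = h \<otimes> k" using that hk0 by simp
      then have "h0 \<otimes> (k0 \<otimes> inv k) = h"
        using that hk0 HG KG by (metis inv_closed inv_solve_right m_assoc m_closed)
      then show ?thesis
        using that hk0 HG KG by (metis inv_closed inv_solve_left m_closed)
    qed
    show ?thesis
    proof (rule card_inj_on_le)
      show "(\<lambda>z. inv h0 \<otimes> fst z) ` ?F y \<subseteq> H \<inter> K"
      proof (rule image_subsetI)
        fix z assume z: "z \<in> ?F y"
        obtain h k where hk: "z = (h, k)" by force
        then have "h \<in> H" "k \<in> K" "h \<otimes> k = y"
          using z by auto
        then show "inv h0 \<otimes> fst z \<in> H \<inter> K"
          using eq[of h k] hk0 H K hk by (metis IntI fst_conv subgroup.m_closed subgroup.m_inv_closed)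
      qed
      show "inj_on (\<lambda>z. inv h0 \<otimes> fst z) (?F y)"
      proof (rule inj_onI)
        fix z z' assume z: "z \<in> ?F y" "z' \<in> ?F y" and "inv h0 \<otimes> fst z = inv h0 \<otimes> fst z'"
        moreover from this have "fst z = fst z'"
          using hk0 HG by auto
        ultimately show "z = z'"
          using HG KG by auto
      qed
    qed (use fin in auto)
  next
    case True
    show ?thesis unfolding True by simp
  qed
  have "H \<times> K = (\<Union>y \<in> H <#> K. ?F y)"
    unfolding set_mult_def by auto
  then have "card H * card K = card (\<Union>y \<in> H <#> K. ?F y)"
    by (metis card_cartesian_product)
  also have "\<dots> \<le> (\<Sum>y \<in> H <#> K. card (?F y))"
    by (rule card_UN_le) (simp add: set_mult_def fin)
  also have "\<dots> \<le> card (H <#> K) * card (H \<inter> K)"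
    using sum_mono[of "H <#> K" "\<lambda>y. card (?F y)" "\<lambda>_. card (H \<inter> K)", OF fib] by simp
  finally show ?thesis .
qed

text \<open>Suppose that \<open>H\<close> differs from its conjugate \<open>K = H\<^sup>g\<close>. Then \<open>H \<inter> K\<close> has index at least \<open>p\<close> in
  \<open>K\<close>, which makes the set \<open>H K\<close> so large that it is all of \<open>G\<close>. In particular \<open>g \<in> H K\<close>, which puts
  \<open>g\<close> into \<open>H\<close> and gives \<open>K = H\<close>.\<close>

lemma normal_if_smallest_index:
  assumes H: "subgroup H G" and index: "p * card H = order G"
  shows "H \<lhd> G"
  unfolding normal_inv_iff
proof (intro conjI ballI)
  show "subgroup H G" by fact
  fix g h assume g: "g \<in> carrier G" and h: "h \<in> H"
  let ?K = "(\<lambda>h. inv g \<otimes> h \<otimes> g) ` H"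
  have HG: "h \<in> carrier G" if "h \<in> H" for h
    using that H subgroup.mem_carrier by metis
  have K: "subgroup ?K G"
  proof (rule subgroupI)
    show "?K \<subseteq> carrier G" "?K \<noteq> {}"
      using g HG h by auto
  next
    fix a assume "a \<in> ?K"
    then obtain x where x: "x \<in> H" "a = inv g \<otimes> x \<otimes> g" by auto
    then have "inv a = inv g \<otimes> inv x \<otimes> g"
      using g HG by (simp add: inv_mult_group m_assoc)
    then show "inv a \<in> ?K"
      using x(1) H by (auto simp: subgroup.m_inv_closed)
  next
    fix a b assume "a \<in> ?K" "b \<in> ?K"
    then obtain x y where x: "x \<in> H" "a = inv g \<otimes> x \<otimes> g" and y: "y \<in> H" "b = inv g \<otimes> y \<otimes> g"
      by auto
    have "g \<otimes> (inv g \<otimes> (y \<otimes> g)) = y \<otimes> g"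
      using y g HG by (simp flip: m_assoc)
    then have "a \<otimes> b = inv g \<otimes> (x \<otimes> y) \<otimes> g"
      using x y g HG by (simp add: m_assoc)
    then show "a \<otimes> b \<in> ?K"
      using x(1) y(1) H by (auto simp: subgroup.m_closed)
  qed
  have "inj_on (\<lambda>h. inv g \<otimes> h \<otimes> g) H"
    using g HG by (auto intro!: inj_onI)
  then have cK: "card ?K = card H"
    by (rule card_image)
  have "H \<inter> ?K = ?K"
  proof (rule ccontr)
    assume neq: "H \<inter> ?K \<noteq> ?K"
    have I: "subgroup (H \<inter> ?K) G"
      using H K by (rule subgroups_Inter_pair)
    interpret GK: group "G\<lparr>carrier := ?K\<rparr>"
      using subgroup.subgroup_is_group[OF K] is_group by blast
    have "subgroup (H \<inter> ?K) (G\<lparr>carrier := ?K\<rparr>)"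
      using subgroup_incl[OF I K] by blast
    from GK.lagrange[OF this] obtain i where i: "i * card (H \<inter> ?K) = card H"
      by (simp add: order_def cK)
    have "i * card (H \<inter> ?K) dvd order G"
      unfolding i using index by (metis dvd_triv_right)
    moreover have "i * card (H \<inter> ?K) \<noteq> card (H \<inter> ?K)"
      unfolding i using neq cK card_subset_eq[OF subgroup_finite[OF K], of "H \<inter> ?K"] by auto
    ultimately have large: "p * card (H \<inter> ?K) \<le> card H"
      using proper_quotient_ge[of i "card (H \<inter> ?K)"] i by simp
    have "p * card H * card H \<le> p * (card (H <#> ?K) * card (H \<inter> ?K))"
      using card_mult_le_card_set_mult[OF H K] cK by simp
    also have "\<dots> = card (H <#> ?K) * (p * card (H \<inter> ?K))"
      by simp
    also have "\<dots> \<le> card (H <#> ?K) * card H"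
      using large by (rule mult_le_mono2)
    finally have "order G * card H \<le> card (H <#> ?K) * card H"
      by (simp add: index)
    moreover have "card H > 0"
      using subgroup_finite[OF H] h by (auto simp: card_gt_0_iff)
    ultimately have "order G \<le> card (H <#> ?K)"
      by simp
    moreover have "H <#> ?K \<subseteq> carrier G"
      using H K by (simp add: setmult_subset_G subgroup.subset)
    ultimately have "H <#> ?K = carrier G"
      using finite_carrier unfolding order_def by (meson card_seteq)
    then obtain a b where ab: "a \<in> H" "b \<in> H" "g = a \<otimes> (inv g \<otimes> b \<otimes> g)"
      using g unfolding set_mult_def by blast
    have c: "a \<in> carrier G" "b \<in> carrier G" using ab HG by auto
    have "\<one> \<otimes> g = (a \<otimes> inv g \<otimes> b) \<otimes> g"
      using ab(3) c g by (simp add: m_assoc)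
    then have "a \<otimes> inv g \<otimes> b = \<one>"
      using c g by (metis inv_closed m_closed one_closed right_cancel)
    then have "inv b = a \<otimes> inv g"
      using c g by (intro inv_equality) auto
    then have "inv g = inv a \<otimes> inv b"
      using c g by (simp add: inv_solve_left)
    then have "inv g \<in> H"
      using ab H by (simp add: subgroup.m_closed subgroup.m_inv_closed)
    then have "g \<in> H"
      using g H by (metis inv_inv subgroup.m_inv_closed)
    then have "?K \<subseteq> H"
      using H by (auto simp: subgroup.m_closed subgroup.m_inv_closed)
    then show False using neq by blast
  qed
  then have "?K \<subseteq> H" by blast
  then have "?K = H"
    using cK card_subset_eq[OF subgroup_finite[OF H]] by blast
  then obtain x where x: "x \<in> H" "h = inv g \<otimes> x \<otimes> g" using h by blast
  moreover have "g \<otimes> (inv g \<otimes> x) = x"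
    using x(1) g HG by (simp flip: m_assoc)
  ultimately have "g \<otimes> h \<otimes> inv g = x"
    using g HG by (simp add: m_assoc)
  then show "g \<otimes> h \<otimes> inv g \<in> H" using x(1) by simp
qed

text \<open>The quotient by \<open>H\<close> has prime order \<open>p\<close>, hence is abelian.\<close>

lemma commutator_mem_if_smallest_index:
  assumes H: "subgroup H G" and index: "p * card H = order G"
    and a: "a \<in> carrier G" and b: "b \<in> carrier G"
  shows "a \<otimes> b \<otimes> inv a \<otimes> inv b \<in> H"
proof -
  interpret H: normal H G
    using H index by (rule normal_if_smallest_index)
  interpret Q: group "G Mod H"
    by (rule H.factorgroup_is_group)
  have "card H > 0"
    using subgroup_finite[OF H] H.one_closed card_gt_0_iff by blast
  then have "order (G Mod H) = p"
    using lagrange[OF H] unfolding index[symmetric] by (simp add: order_def FactGroup_def)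
  then interpret Q: comm_group "G Mod H"
    using Q.prime_order_imp_comm_group prime_p by simp
  have "(H #> a) <#> (H #> b) = (H #> b) <#> (H #> a)"
    using Q.m_comm[of "H #> a" "H #> b"] a b by (simp add: carrier_FactGroup)
  then have "H #> (a \<otimes> b) = H #> (b \<otimes> a)"
    using a b by (simp add: H.rcos_sum)
  then have "a \<otimes> b \<in> H #> (b \<otimes> a)"
    using rcos_self[OF _ H, of "a \<otimes> b"] a b by simp
  then obtain h where h: "h \<in> H" "a \<otimes> b = h \<otimes> (b \<otimes> a)"
    unfolding r_coset_def by blast
  have "a \<otimes> b \<otimes> inv a \<otimes> inv b = a \<otimes> b \<otimes> inv (b \<otimes> a)"
    using a b by (simp add: inv_mult_group m_assoc)
  also have "\<dots> = h \<otimes> (b \<otimes> a) \<otimes> inv (b \<otimes> a)"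
    by (simp only: h(2))
  also have "\<dots> = h"
    using h(1) a b H.mem_carrier[of h] m_assoc[of h "b \<otimes> a" "inv (b \<otimes> a)"] by simp
  finally show ?thesis
    using h(1) by simp
qed

end

section \<open>Counting tuples for a commutation relation\<close>

text \<open>The combinatorial content of commuting lifts: \<open>y \<in> C x\<close> is a reflexive and symmetric relation whose
  sections are subgroups and to whose centre only the neutral element belongs. For commuting
  lifts it is finer than commutation in \<open>G\<close> itself.\<close>

locale commutation = smallest_prime_group G p for G (structure) and p +
  fixes C :: "'a \<Rightarrow> 'a set"
  assumes subgroup_C: "x \<in> carrier G \<Longrightarrow> subgroup (C x) G"
    and C_refl: "x \<in> carrier G \<Longrightarrow> x \<in> C x"
    and C_sym: "x \<in> carrier G \<Longrightarrow> y \<in> C x \<Longrightarrow> x \<in> C y"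
    and C_faithful: "x \<in> carrier G \<Longrightarrow> C x = carrier G \<Longrightarrow> x = \<one>"
    and not_abelian: "\<not> comm_group G"
begin

lemma C_subset: "x \<in> carrier G \<Longrightarrow> C x \<subseteq> carrier G"
  using subgroup_C subgroup.subset by blast

lemma C_one: "C \<one> = carrier G"
  using C_subset[of \<one>] C_sym subgroup_C subgroup.one_closed by blast

lemma card_C_le:
  assumes "x \<in> carrier G" "x \<noteq> \<one>"
  shows "p * card (C x) \<le> order G"
  using assms C_faithful subgroup_C card_proper_subgroup_le by blast

text \<open>The elements \<open>x \<noteq> \<one>\<close> for which \<open>C x\<close> is as large as it can be, with index \<open>p\<close>.\<close>

definition large :: "'a set" where
  "large = {x \<in> carrier G. p * card (C x) = order G}"

lemma large_subset: "large \<subseteq> carrier G"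
  by (auto simp: large_def)

lemma one_not_large: "\<one> \<notin> large"
  using C_one order_pos p_ge_2 by (auto simp: large_def order_def)

text \<open>For \<open>x\<close> in \<^term>\<open>large\<close>, every commutator \<open>c\<close> of \<open>G\<close> lies in \<open>C x\<close>, so by symmetry \<open>x \<in> C c\<close>. If these
  \<open>x\<close> generated \<open>G\<close>, then \<open>C c\<close> would be everything and \<open>c\<close> trivial.\<close>

lemma generate_large_neq_carrier: "generate G large \<noteq> carrier G"
proof
  assume gen: "generate G large = carrier G"
  have "a \<otimes> b = b \<otimes> a" if a: "a \<in> carrier G" and b: "b \<in> carrier G" for a b
  proof -
    define c where "c = a \<otimes> b \<otimes> inv a \<otimes> inv b"
    have c: "c \<in> carrier G"
      using a b by (simp add: c_def)
    have "large \<subseteq> C c"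
      using commutator_mem_if_smallest_index a b C_sym subgroup_C
      unfolding c_def large_def by blast
    then have "C c = carrier G"
      using generate_subgroup_incl[OF _ subgroup_C[OF c]] gen C_subset[OF c] by blast
    then have "c = \<one>"
      by (rule C_faithful[OF c])
    then have "a \<otimes> b \<otimes> inv (b \<otimes> a) = \<one>"
      using a b by (simp add: c_def inv_mult_group m_assoc)
    then show ?thesis
      using a b by (metis inv_solve_right l_one m_closed one_closed)
  qed
  then have "comm_group G"
    by (rule group_comm_groupI)
  then show False
    using not_abelian by blast
qed

lemma card_large_le: "p * (card large + 1) \<le> order G"
proof -
  have "subgroup (generate G large) G"
    using large_subset by (rule generate_is_subgroup)
  moreover have "card (insert \<one> large) \<le> card (generate G large)"
    using subgroup_finite[OF calculation] generate.one generate.incl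
    by (intro card_mono) auto
  moreover have "card (insert \<one> large) = card large + 1"
    using one_not_large large_subset finite_carrier finite_subset by fastforce
  ultimately show ?thesis
    using card_proper_subgroup_le generate_large_neq_carrier
    by (metis le_trans mult_le_mono2)
qed

text \<open>For \<open>x \<noteq> \<one>\<close> both the order and the index of \<open>C x\<close> are at least \<open>p\<close>. If \<open>|G| < p (p + 1)\<close>, the index
  cannot exceed \<open>p\<close>, so that every \<open>x \<noteq> \<one>\<close> is in \<^term>\<open>large\<close>, contrary to \<open>generate_large_neq_carrier\<close>.\<close>

lemma order_ge: "p * (p + 1) \<le> order G"
proof (rule ccontr)
  assume "\<not> ?thesis"
  then have small: "order G < p * (p + 1)" by simp
  have "x \<in> large" if x: "x \<in> carrier G" "x \<noteq> \<one>" for x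
  proof -
    have "C x \<noteq> {\<one>}"
      using C_refl x by blast
    then have "p \<le> card (C x)"
      using card_subgroup_ge subgroup_C x by blast
    moreover obtain i where i: "order G = i * card (C x)"
      using lagrange[OF subgroup_C[OF x(1)]] by metis
    moreover have "p \<le> i"
      using card_C_le[OF x] i \<open>p \<le> card (C x)\<close> p_ge_2 by simp
    ultimately have "order G = p * card (C x)"
    proof -
      have "i < p + 1"
      proof (rule ccontr)
        assume "\<not> i < p + 1"
        then have "(p + 1) * p \<le> i * card (C x)"
          using \<open>p \<le> card (C x)\<close> by (intro mult_le_mono) auto
        then show False using small i by (simp add: mult.commute)
      qed
      then show ?thesis using \<open>p \<le> i\<close> i by simp
    qed
    then show ?thesis using x by (simp add: large_def)
  qed
  then have "carrier G \<subseteq> generate G large"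
    using generate.one[of G large] generate.incl[of _ large G] by blast
  then show False
    using generate_large_neq_carrier generate_incl[OF large_subset] by blast
qed

text \<open>Elements outside \<^term>\<open>large\<close> other than \<open>\<one>\<close> have index at least \<open>p + 1\<close>. Inserting the bounds \<open>|G|\<close>,
  \<open>|G| / p\<close> and \<open>|G| / (p + 1)\<close> for the three kinds of elements turns the claim into
  \<open>p\<^sup>2 + |large| \<le> |G|\<close>.\<close>

lemma sum_card_C_le: "p * (\<Sum>x \<in> carrier G. card (C x)) \<le> order G * order G"
proof -
  let ?n = "order G" and ?a = "card large" and ?rest = "carrier G - large - {\<one>}"
  have fin: "finite large" "finite ?rest"
    using large_subset finite_carrier finite_subset by auto
  have dec: "carrier G = insert \<one> (large \<union> ?rest)"
    using large_subset by auto
  have n: "?n = 1 + ?a + card ?rest"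
  proof -
    have "?n = card (insert \<one> (large \<union> ?rest))"
      using dec by (simp add: order_def)
    also have "\<dots> = Suc (card (large \<union> ?rest))"
      using fin one_not_large by simp
    also have "card (large \<union> ?rest) = ?a + card ?rest"
      using fin by (intro card_Un_disjoint) auto
    finally show ?thesis by simp
  qed
  have "(\<Sum>x \<in> carrier G. card (C x)) = (\<Sum>x \<in> insert \<one> (large \<union> ?rest). card (C x))"
    using dec by simp
  also have "\<dots> = ?n + (\<Sum>x \<in> large \<union> ?rest. card (C x))"
    using fin one_not_large by (simp add: C_one order_def)
  also have "(\<Sum>x \<in> large \<union> ?rest. card (C x))
      = (\<Sum>x \<in> large. card (C x)) + (\<Sum>x \<in> ?rest. card (C x))"
    using fin by (intro sum.union_disjoint) auto
  finally have split: "(\<Sum>x \<in> carrier G. card (C x))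
      = ?n + (\<Sum>x \<in> large. card (C x)) + (\<Sum>x \<in> ?rest. card (C x))" by simp
  have sum_large: "p * (\<Sum>x \<in> large. card (C x)) = ?a * ?n"
    by (simp add: sum_distrib_left large_def)
  have "(p + 1) * card (C x) \<le> ?n" if x: "x \<in> ?rest" for x
  proof -
    obtain i where i: "order G = i * card (C x)"
      using lagrange[OF subgroup_C] x by (metis DiffD1)
    have "p * card (C x) < i * card (C x)"
      using card_C_le[of x] x i unfolding large_def by auto
    then have "p + 1 \<le> i" by simp
    then show ?thesis unfolding i by (rule mult_le_mono1)
  qed
  then have sum_rest: "(p + 1) * (\<Sum>x \<in> ?rest. card (C x)) \<le> card ?rest * ?n"
    using sum_bounded_above[of ?rest "\<lambda>x. (p + 1) * card (C x)" ?n]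
    by (simp add: sum_distrib_left)
  have pa: "p * p + ?a \<le> ?n"
  proof -
    obtain r where r: "p = r + 2"
      using p_ge_2 by (metis add.commute le_Suc_ex)
    obtain m where m: "?n = p * m"
      using p_dvd_order by blast
    have "?a + 1 \<le> m" "p + 1 \<le> m"
      using card_large_le order_ge p_ge_2 unfolding m by (simp_all only: mult_le_cancel1)
    \<comment> \<open>Since \<open>|G| = (p - 1) m + m\<close>, one summand is bounded by each of the two estimates for \<open>m\<close>.\<close>
    then have "(p - 1) * (p + 1) + (?a + 1) \<le> (p - 1) * m + m"
      by (intro add_mono mult_le_mono) auto
    then show ?thesis
      unfolding m r by (simp add: algebra_simps)
  qed
  \<comment> \<open>Multiplying by \<open>p (p + 1)\<close> clears the denominators of both bounds.\<close>
  have "(p + 1) * (p * (\<Sum>x \<in> carrier G. card (C x)))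
      = p * (p + 1) * ?n + (p + 1) * (p * (\<Sum>x \<in> large. card (C x)))
        + p * ((p + 1) * (\<Sum>x \<in> ?rest. card (C x)))"
    unfolding split by (simp add: algebra_simps)
  also have "\<dots> \<le> p * (p + 1) * ?n + (p + 1) * (?a * ?n) + p * (card ?rest * ?n)"
    unfolding sum_large using sum_rest by (intro add_mono mult_le_mono2) auto
  also have "\<dots> = (p * (1 + ?a + card ?rest) + (p * p + ?a)) * ?n"
    by (simp add: algebra_simps)
  also have "\<dots> \<le> (p * ?n + ?n) * ?n"
    using pa n by (intro mult_le_mono1 add_mono) auto
  also have "\<dots> = (p + 1) * (?n * ?n)"
    by (simp add: algebra_simps)
  finally show ?thesis
    by (simp only: mult_le_cancel1)
qed

text \<open>Indices start at 1, in agreement with the tuples in the definition of the exterior degree.\<close>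

definition tuples :: "nat \<Rightarrow> (nat \<Rightarrow> 'a) set" where
  "tuples m = {x \<in> {1..m} \<rightarrow>\<^sub>E carrier G. \<forall>i \<in> {1..m}. \<forall>j \<in> {1..m}. x j \<in> C (x i)}"

lemma finite_tuples: "finite (tuples m)"
  by (rule finite_subset[of _ "{1..m} \<rightarrow>\<^sub>E carrier G"])
    (auto simp: tuples_def finite_carrier intro!: finite_PiE)

lemma inj_on_restrict_last:
  "inj_on (\<lambda>x. restrict x {1..m}) {x \<in> tuples (Suc m). x (Suc m) = y}"
proof (rule inj_onI, rule ext)
  fix x x' i
  assume x: "x \<in> {x \<in> tuples (Suc m). x (Suc m) = y}" "x' \<in> {x \<in> tuples (Suc m). x (Suc m) = y}"
    and eq: "restrict x {1..m} = restrict x' {1..m}"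
  consider "i \<in> {1..m}" | "i = Suc m" | "i \<notin> {1..Suc m}"
    by force
  then show "x i = x' i"
  proof cases
    case 1
    then show ?thesis using eq by (metis restrict_apply')
  next
    case 3
    then show ?thesis using x by (auto simp: tuples_def PiE_def extensional_def)
  qed (use x in auto)
qed

lemma card_tuples_last_le: "card {x \<in> tuples (Suc m). x (Suc m) = y} \<le> card (tuples m)"
proof (rule card_inj_on_le[OF inj_on_restrict_last _ finite_tuples])
  show "(\<lambda>x. restrict x {1..m}) ` {x \<in> tuples (Suc m). x (Suc m) = y} \<subseteq> tuples m"
    by (auto simp: tuples_def PiE_iff)
qed

text \<open>All entries of the tuple belong to \<open>C y\<close>; the relations among the remaining entries are given up here.\<close>

lemma card_tuples_last_le_C:
  assumes "y \<in> carrier G"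
  shows "card {x \<in> tuples (Suc m). x (Suc m) = y} \<le> card (C y) ^ m"
proof -
  have "(\<lambda>x. restrict x {1..m}) ` {x \<in> tuples (Suc m). x (Suc m) = y} \<subseteq> {1..m} \<rightarrow>\<^sub>E C y"
    by (auto simp: tuples_def)
  then have "card {x \<in> tuples (Suc m). x (Suc m) = y} \<le> card ({1..m} \<rightarrow>\<^sub>E C y)"
    using assms by (intro card_inj_on_le[OF inj_on_restrict_last])
      (auto intro!: finite_PiE subgroup_finite subgroup_C)
  then show ?thesis
    by (simp add: card_PiE)
qed

lemma card_tuples_Suc_le:
  "card (tuples (Suc m)) \<le> card (tuples m) + (\<Sum>y \<in> carrier G - {\<one>}. card (C y) ^ m)"
proof -
  have "x (Suc m) \<in> carrier G" if "x \<in> tuples (Suc m)" for x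
    using that by (simp add: tuples_def PiE_iff)
  then have "tuples (Suc m) = (\<Union>y \<in> carrier G. {x \<in> tuples (Suc m). x (Suc m) = y})"
    by blast
  then have "card (tuples (Suc m)) = card (\<Union>y \<in> carrier G. {x \<in> tuples (Suc m). x (Suc m) = y})"
    by (rule arg_cong)
  also have "\<dots> \<le> (\<Sum>y \<in> carrier G. card {x \<in> tuples (Suc m). x (Suc m) = y})"
    by (rule card_UN_le[OF finite_carrier])
  also have "\<dots> = card {x \<in> tuples (Suc m). x (Suc m) = \<one>}
      + (\<Sum>y \<in> carrier G - {\<one>}. card {x \<in> tuples (Suc m). x (Suc m) = y})"
    by (rule sum.remove) (auto simp: finite_carrier)
  also have "\<dots> \<le> card (tuples m) + (\<Sum>y \<in> carrier G - {\<one>}. card (C y) ^ m)"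
    by (intro add_mono sum_mono card_tuples_last_le card_tuples_last_le_C) auto
  finally show ?thesis .
qed

lemma card_tuples_1: "card (tuples 1) = order G"
proof -
  have "tuples 1 = {1} \<rightarrow>\<^sub>E carrier G"
    unfolding tuples_def using C_refl by auto
  then show ?thesis
    by (simp add: card_PiE order_def)
qed

text \<open>In the induction step, the factors \<open>p |C y| \<le> |G|\<close> for \<open>y \<noteq> \<one>\<close> are used up to a single one. What remains
  of the sum over \<open>y\<close> is then \<open>p (\<Sum>y. |C y|)\<close>, where the induction hypothesis contributes exactly the
  missing summand \<open>|C \<one>| = |G|\<close>.\<close>

lemma card_tuples_le: "p ^ n * card (tuples (n + 1)) \<le> order G ^ (n + 1)"
proof (induction n)
  case 0
  show ?case using card_tuples_1 by simp
next
  case (Suc n)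
  let ?n = "order G"
  have "p ^ Suc n * card (C y) ^ Suc n \<le> ?n ^ n * (p * card (C y))"
    if "y \<in> carrier G - {\<one>}" for y
  proof -
    have "(p * card (C y)) ^ n \<le> ?n ^ n"
      using card_C_le that by (intro power_mono) auto
    then have "(p * card (C y)) ^ Suc n \<le> ?n ^ n * (p * card (C y))"
      unfolding power_Suc2 by (rule mult_le_mono1)
    then show ?thesis
      unfolding power_mult_distrib .
  qed
  then have nontrivial: "(\<Sum>y \<in> carrier G - {\<one>}. p ^ Suc n * card (C y) ^ Suc n)
      \<le> (\<Sum>y \<in> carrier G - {\<one>}. ?n ^ n * (p * card (C y)))"
    by (rule sum_mono)
  have "p ^ Suc n * card (tuples (Suc n + 1))
      \<le> p ^ Suc n * (card (tuples (n + 1)) + (\<Sum>y \<in> carrier G - {\<one>}. card (C y) ^ Suc n))"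
    using card_tuples_Suc_le[of "Suc n"] by (intro mult_le_mono2) simp
  also have "\<dots> = p * (p ^ n * card (tuples (n + 1)))
      + (\<Sum>y \<in> carrier G - {\<one>}. p ^ Suc n * card (C y) ^ Suc n)"
    by (simp add: distrib_left sum_distrib_left mult.assoc)
  also have "\<dots> \<le> p * ?n ^ (n + 1) + (\<Sum>y \<in> carrier G - {\<one>}. ?n ^ n * (p * card (C y)))"
    using Suc.IH nontrivial by (intro add_mono mult_le_mono2)
  also have "\<dots> = ?n ^ n * (p * (card (C \<one>) + (\<Sum>y \<in> carrier G - {\<one>}. card (C y))))"
    by (simp add: C_one order_def distrib_left sum_distrib_left ac_simps)
  also have "card (C \<one>) + (\<Sum>y \<in> carrier G - {\<one>}. card (C y)) = (\<Sum>y \<in> carrier G. card (C y))"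
    by (rule sum.remove[symmetric]) (auto simp: finite_carrier)
  also have "?n ^ n * (p * (\<Sum>y \<in> carrier G. card (C y))) \<le> ?n ^ n * (?n * ?n)"
    using sum_card_C_le by (rule mult_le_mono2)
  finally show ?case by (simp add: ac_simps)
qed

end

section \<open>Homomorphisms out of a presented group\<close>

definition word_value :: "('c, 'd) monoid_scheme \<Rightarrow> ('x \<Rightarrow> 'c) \<Rightarrow> 'x word \<Rightarrow> 'c" where
  "word_value H f w =
     foldr (\<lambda>(x, e) a. (if e then f x else inv\<^bsub>H\<^esub> f x) \<otimes>\<^bsub>H\<^esub> a) w \<one>\<^bsub>H\<^esub>"

context group
begin

lemma word_value_Nil [simp]: "word_value G f [] = \<one>"
  by (simp add: word_value_def)

lemma word_value_Cons:
  "word_value G f ((x, e) # w) = (if e then f x else inv f x) \<otimes> word_value G f w"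
  by (simp add: word_value_def)

lemma word_value_closed:
  assumes "f \<in> S \<rightarrow> carrier G" "w \<in> words S"
  shows "word_value G f w \<in> carrier G"
  using assms(2)
proof (induction w)
  case (Cons l w)
  obtain x e where l: "l = (x, e)" by force
  have "f x \<in> carrier G"
    using Cons.hyps(1) assms(1) l by auto
  then show ?case
    using Cons.IH by (simp add: l word_value_Cons)
qed simp

lemma word_value_append:
  assumes "f \<in> S \<rightarrow> carrier G" "u \<in> words S" "v \<in> words S"
  shows "word_value G f (u @ v) = word_value G f u \<otimes> word_value G f v"
  using assms(2)
proof (induction u)
  case Nil
  show ?case using word_value_closed[OF assms(1,3)] by simp
next
  case (Cons l u)
  obtain x e where l: "l = (x, e)" by force
  have "f x \<in> carrier G"
    using Cons.hyps(1) assms(1) l by auto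
  then show ?case
    using Cons word_value_closed[OF assms(1)] assms(3)
    by (simp add: l word_value_Cons m_assoc)
qed

lemma word_value_cong:
  assumes f: "f \<in> S \<rightarrow> carrier G"
    and rel: "\<And>u v. (u, v) \<in> R \<Longrightarrow> u \<in> words S \<Longrightarrow> v \<in> words S
      \<Longrightarrow> word_value G f u = word_value G f v"
    and uv: "(u, v) \<in> presentation_rel S R"
  shows "word_value G f u = word_value G f v"
  using uv
proof (induction rule: presentation_rel.induct)
  case (append u u' v v')
  then show ?case
    using presentation_rel_words by (metis word_value_append[OF f])
next
  case (cancel x e)
  then have "f x \<in> carrier G"
    using f by blast
  then show ?case
    by (cases e) (simp_all add: word_value_Cons)
qed (use rel in auto)

text \<open>Von Dyck's theorem: an assignment of generators that respects the relations extends to a homomorphism.\<close>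

proposition presented_group_universal:
  assumes f: "f \<in> S \<rightarrow> carrier G"
    and rel: "\<And>u v. (u, v) \<in> R \<Longrightarrow> u \<in> words S \<Longrightarrow> v \<in> words S
      \<Longrightarrow> word_value G f u = word_value G f v"
  obtains \<theta> where "\<theta> \<in> hom (presented_group S R) G"
    and "\<And>x. x \<in> S \<Longrightarrow> \<theta> (presented_gen S R x) = f x"
proof
  let ?\<theta> = "\<lambda>X. the_elem (word_value G f ` X)"
  have \<theta>: "?\<theta> (presentation_rel S R `` {u}) = word_value G f u" if "u \<in> words S" for u
  proof -
    have "word_value G f ` (presentation_rel S R `` {u}) = {word_value G f u}"
    proof (intro equalityI subsetI)
      fix y assume "y \<in> word_value G f ` (presentation_rel S R `` {u})"
      then show "y \<in> {word_value G f u}"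
        using word_value_cong[OF f rel] by fastforce
    next
      fix y assume "y \<in> {word_value G f u}"
      then show "y \<in> word_value G f ` (presentation_rel S R `` {u})"
        using presentation_rel.refl[OF that] by auto
    qed
    then show ?thesis by simp
  qed
  have carr: "carrier (presented_group S R) = (\<lambda>u. presentation_rel S R `` {u}) ` words S"
    by (auto simp: presented_group_def quotient_def)
  show "?\<theta> \<in> hom (presented_group S R) G"
  proof (rule homI)
    fix X assume "X \<in> carrier (presented_group S R)"
    then obtain u where "u \<in> words S" "X = presentation_rel S R `` {u}"
      unfolding carr by blast
    then show "?\<theta> X \<in> carrier G"
      using word_value_closed[OF f] by (simp only: \<theta>)
  next
    fix X Y assume "X \<in> carrier (presented_group S R)" "Y \<in> carrier (presented_group S R)"
    then obtain u v where "u \<in> words S" "X = presentation_rel S R `` {u}"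
      "v \<in> words S" "Y = presentation_rel S R `` {v}"
      by (auto simp: carr)
    then show "?\<theta> (X \<otimes>\<^bsub>presented_group S R\<^esub> Y) = ?\<theta> X \<otimes> ?\<theta> Y"
      by (simp add: presented_group_mult \<theta> word_value_append[OF f])
  qed
  show "?\<theta> (presented_gen S R x) = f x" if "x \<in> S" for x
  proof -
    have "?\<theta> (presented_gen S R x) = word_value G f [(x, True)]"
      unfolding presented_gen_def using that by (intro \<theta>) auto
    then show ?thesis
      using that f funcset_mem[OF f that] by (simp add: word_value_Cons)
  qed
qed

end

text \<open>A map satisfying the relations of the exterior square factors through it, so it must vanish wherever
  the wedge does. On the level of the tensor square: the kernel of the induced homomorphism is a normal
  subgroup containing all \<open>g \<otimes> g\<close>, and therefore contains the exterior kernel.\<close>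

lemma (in group) exterior_pairing_eq_one:
  fixes K :: "('k, 'm) monoid_scheme" and b :: "'k \<Rightarrow> 'k \<Rightarrow> 'a"
  assumes K: "group K"
    and closed: "\<And>g h. g \<in> carrier K \<Longrightarrow> h \<in> carrier K \<Longrightarrow> b g h \<in> carrier G"
    and left: "\<And>g h k. g \<in> carrier K \<Longrightarrow> h \<in> carrier K \<Longrightarrow> k \<in> carrier K
      \<Longrightarrow> b (g \<otimes>\<^bsub>K\<^esub> k) h = b (conjugate K g k) (conjugate K g h) \<otimes> b g h"
    and right: "\<And>g h k. g \<in> carrier K \<Longrightarrow> h \<in> carrier K \<Longrightarrow> k \<in> carrier K
      \<Longrightarrow> b g (h \<otimes>\<^bsub>K\<^esub> k) = b g h \<otimes> b (conjugate K h g) (conjugate K h k)"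
    and alt: "\<And>g. g \<in> carrier K \<Longrightarrow> b g g = \<one>"
    and x: "x \<in> carrier K" and y: "y \<in> carrier K"
    and wedge: "wedge K x y = \<one>\<^bsub>exterior_square K\<^esub>"
  shows "b x y = \<one>"
proof -
  interpret K: group K by fact
  interpret T: group "tensor_square K"
    by (simp add: tensor_square_def group_presented_group)
  have conj: "conjugate K g h \<in> carrier K" if "g \<in> carrier K" "h \<in> carrier K" for g h
    using that by (simp add: conjugate_def)
  obtain \<theta> where \<theta>: "\<theta> \<in> hom (tensor_square K) G"
    and gen: "\<And>g h. g \<in> carrier K \<Longrightarrow> h \<in> carrier K \<Longrightarrow> \<theta> (tensor K g h) = b g h"
  proof (rule presented_group_universal[of "\<lambda>(g, h). b g h" "carrier K \<times> carrier K" "tensor_relations K"])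
    show "(\<lambda>(g, h). b g h) \<in> carrier K \<times> carrier K \<rightarrow> carrier G"
      using closed by auto
    show "word_value G (\<lambda>(g, h). b g h) u = word_value G (\<lambda>(g, h). b g h) v"
      if "(u, v) \<in> tensor_relations K" for u v
      using that unfolding tensor_relations_def
    proof (elim UnE CollectE exE conjE Pair_inject)
      fix g h k assume "g \<in> carrier K" "h \<in> carrier K" "k \<in> carrier K"
        and uv: "u = [((g \<otimes>\<^bsub>K\<^esub> k, h), True)]"
          "v = [((conjugate K g k, conjugate K g h), True), ((g, h), True)]"
      then show ?thesis
        unfolding uv by (simp add: word_value_Cons closed left conj)
    next
      fix g h k assume "g \<in> carrier K" "h \<in> carrier K" "k \<in> carrier K"
        and uv: "u = [((g, h \<otimes>\<^bsub>K\<^esub> k), True)]"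
          "v = [((g, h), True), ((conjugate K h g, conjugate K h k), True)]"
      then show ?thesis
        unfolding uv by (simp add: word_value_Cons closed right conj)
    qed
  qed (auto simp: tensor_square_def tensor_def)
  interpret \<theta>: group_hom "tensor_square K" G \<theta>
    using \<theta> by unfold_locales
  have tensor_closed: "tensor K g h \<in> carrier (tensor_square K)"
    if "g \<in> carrier K" "h \<in> carrier K" for g h
    using that by (auto simp: tensor_def presented_gen_def tensor_square_def presented_group_def
        intro!: quotientI)
  have "{tensor K g g |g. g \<in> carrier K} \<subseteq> kernel (tensor_square K) G \<theta>"
    by (auto simp: kernel_def alt gen tensor_closed)
  then have "exterior_kernel K \<subseteq> kernel (tensor_square K) G \<theta>"
    unfolding exterior_kernel_def normal_closure_def using \<theta>.normal_kernel by blast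
  moreover have "tensor K x y \<in> exterior_kernel K"
  proof -
    have "exterior_kernel K \<lhd> tensor_square K"
      unfolding exterior_kernel_def using tensor_closed
      by (intro normal_normal_closure T.is_group) auto
    then have "tensor K x y \<in> exterior_kernel K #>\<^bsub>tensor_square K\<^esub> tensor K x y"
      using tensor_closed[OF x y] by (intro T.rcos_self normal_imp_subgroup)
    then show ?thesis
      using wedge by (simp add: wedge_def exterior_square_def)
  qed
  ultimately show ?thesis
    using gen[OF x y] by (auto simp: kernel_def)
qed

section \<open>Commutators of lifts\<close>

definition commutator :: "('a, 'b) monoid_scheme \<Rightarrow> 'a \<Rightarrow> 'a \<Rightarrow> 'a" where
  "commutator G a b = a \<otimes>\<^bsub>G\<^esub> b \<otimes>\<^bsub>G\<^esub> inv\<^bsub>G\<^esub> a \<otimes>\<^bsub>G\<^esub> inv\<^bsub>G\<^esub> b"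

context group
begin

lemma mult_inv_cancel:
  assumes "a \<in> carrier G" "b \<in> carrier G"
  shows "a \<otimes> (inv a \<otimes> b) = b" "inv a \<otimes> (a \<otimes> b) = b"
  using assms by (simp_all flip: m_assoc)

lemma commutator_closed:
  "a \<in> carrier G \<Longrightarrow> b \<in> carrier G \<Longrightarrow> commutator G a b \<in> carrier G"
  by (simp add: commutator_def)

lemma commutator_eq_one_iff:
  assumes "a \<in> carrier G" "b \<in> carrier G"
  shows "commutator G a b = \<one> \<longleftrightarrow> a \<otimes> b = b \<otimes> a"
proof -
  have "commutator G a b = a \<otimes> b \<otimes> inv (b \<otimes> a)"
    using assms by (simp add: commutator_def inv_mult_group m_assoc)
  then show ?thesis
    using assms by (metis inv_solve_right l_one m_closed one_closed)
qed

lemma commutator_mult_left: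
  assumes "a \<in> carrier G" "b \<in> carrier G" "c \<in> carrier G"
  shows "commutator G (a \<otimes> c) b
    = commutator G (conjugate G a c) (conjugate G a b) \<otimes> commutator G a b"
  using assms by (simp add: commutator_def conjugate_def inv_mult_group m_assoc mult_inv_cancel)

lemma commutator_mult_right:
  assumes "a \<in> carrier G" "b \<in> carrier G" "c \<in> carrier G"
  shows "commutator G a (b \<otimes> c)
    = commutator G a b \<otimes> commutator G (conjugate G b a) (conjugate G b c)"
  using assms by (simp add: commutator_def conjugate_def inv_mult_group m_assoc mult_inv_cancel)

lemma inv_commute:
  assumes "a \<in> carrier G" "b \<in> carrier G" "a \<otimes> b = b \<otimes> a"
  shows "a \<otimes> inv b = inv b \<otimes> a"
proof -
  have "inv b \<otimes> (a \<otimes> b) \<otimes> inv b = inv b \<otimes> (b \<otimes> a) \<otimes> inv b"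
    by (simp only: assms(3))
  then show ?thesis
    using assms(1,2) by (simp add: m_assoc mult_inv_cancel)
qed

lemma mult_commute:
  assumes "a \<in> carrier G" "b \<in> carrier G" "c \<in> carrier G"
    and "a \<otimes> b = b \<otimes> a" "a \<otimes> c = c \<otimes> a"
  shows "a \<otimes> (b \<otimes> c) = (b \<otimes> c) \<otimes> a"
proof -
  have "a \<otimes> (b \<otimes> c) = b \<otimes> a \<otimes> c"
    using assms(1-3) by (simp only: assms(4) flip: m_assoc)
  also have "\<dots> = b \<otimes> c \<otimes> a"
    using assms(1-3) by (simp only: assms(5) m_assoc)
  finally show ?thesis .
qed

lemma center_subset: "center G \<subseteq> carrier G"
  by (auto simp: center_def)

lemma commutator_center:
  assumes "a \<in> carrier G" "b \<in> carrier G" "z \<in> center G" "w \<in> center G"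
  shows "commutator G (z \<otimes> a) (w \<otimes> b) = commutator G a b"
proof -
  have z: "z \<in> carrier G" "w \<in> carrier G"
    using assms center_subset by auto
  have comm: "v \<otimes> u = u \<otimes> v" if "v \<in> center G" "u \<in> carrier G" for u v
    using that by (auto simp: center_def)
  have 1: "commutator G (v \<otimes> c) d = commutator G c d"
    if "v \<in> center G" "c \<in> carrier G" "d \<in> carrier G" for v c d
  proof -
    have v: "v \<in> carrier G" using that center_subset by auto
    have "commutator G (v \<otimes> c) d = v \<otimes> (c \<otimes> d \<otimes> inv c) \<otimes> inv v \<otimes> inv d"
      using that v by (simp add: commutator_def inv_mult_group m_assoc)
    also have "\<dots> = c \<otimes> d \<otimes> inv c \<otimes> v \<otimes> inv v \<otimes> inv d"
      using that v comm[of v "c \<otimes> d \<otimes> inv c"] by simp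
    finally show ?thesis
      using that v by (simp add: commutator_def m_assoc mult_inv_cancel)
  qed
  have 2: "commutator G c (v \<otimes> d) = commutator G c d"
    if "v \<in> center G" "c \<in> carrier G" "d \<in> carrier G" for v c d
  proof -
    have v: "v \<in> carrier G" using that center_subset by auto
    have "commutator G c (v \<otimes> d) = c \<otimes> (v \<otimes> (d \<otimes> inv c \<otimes> inv d)) \<otimes> inv v"
      using that v by (simp add: commutator_def inv_mult_group m_assoc)
    also have "v \<otimes> (d \<otimes> inv c \<otimes> inv d) = d \<otimes> inv c \<otimes> inv d \<otimes> v"
      using that v by (intro comm) auto
    finally show ?thesis
      using that v by (simp add: commutator_def m_assoc)
  qed
  show ?thesis
    using 1 2 assms z by simp
qed

lemma center_normal: "center G \<lhd> G"
  unfolding normal_inv_iff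
proof (intro conjI ballI)
  show "subgroup (center G) G"
  proof (rule subgroupI)
    show "center G \<subseteq> carrier G" by (rule center_subset)
    have "\<one> \<in> center G" by (simp add: center_def)
    then show "center G \<noteq> {}" by blast
    fix a assume a: "a \<in> center G"
    then have ac: "a \<in> carrier G" using center_subset by blast
    show "inv a \<in> center G"
      unfolding center_def
    proof (intro CollectI conjI ballI)
      fix g assume g: "g \<in> carrier G"
      have "a \<otimes> g = g \<otimes> a"
        using a g by (simp add: center_def)
      then show "inv a \<otimes> g = g \<otimes> inv a"
        using inv_commute[OF g ac] by simp
    qed (use ac in simp)
    fix b assume b: "b \<in> center G"
    then have bc: "b \<in> carrier G" using center_subset by blast
    show "a \<otimes> b \<in> center G"
      unfolding center_def
    proof (intro CollectI conjI ballI)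
      fix g assume g: "g \<in> carrier G"
      have "a \<otimes> g = g \<otimes> a" "b \<otimes> g = g \<otimes> b"
        using a b g by (simp_all add: center_def)
      then show "a \<otimes> b \<otimes> g = g \<otimes> (a \<otimes> b)"
        using mult_commute[OF g ac bc] by simp
    qed (use ac bc in simp)
  qed
  fix g z assume g: "g \<in> carrier G" and z: "z \<in> center G"
  then have "z \<in> carrier G" "g \<otimes> z = z \<otimes> g"
    by (simp_all add: center_def)
  then have "g \<otimes> z \<otimes> inv g = z"
    using g by (simp add: m_assoc)
  then show "g \<otimes> z \<otimes> inv g \<in> center G" using z by simp
qed

end

text \<open>Capability in terms of a homomorphism: \<open>G\<close> is the image of \<open>E\<close>, and the kernel is the full centre,
  not just a central subgroup.\<close>

locale central_cover = E: group E + G: group G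
  for E :: "('e, 'f) monoid_scheme" (structure) and G :: "('a, 'b) monoid_scheme" +
  fixes \<pi> :: "'e \<Rightarrow> 'a"
  assumes hom: "\<pi> \<in> hom E G"
    and surj: "\<pi> ` carrier E = carrier G"
    and kernel_eq: "kernel E G \<pi> = center E"
begin

sublocale \<pi>: group_hom E G \<pi>
  by (intro group_hom.intro group_hom_axioms.intro E.is_group G.is_group hom)

definition lift :: "'a \<Rightarrow> 'e" where
  "lift x = (SOME a. a \<in> carrier E \<and> \<pi> a = x)"

text \<open>The commutator of lifts. The choice of the lifts does not matter, by \<open>pairing_image\<close> below.\<close>

definition pairing :: "'a \<Rightarrow> 'a \<Rightarrow> 'e" where
  "pairing x y = commutator E (lift x) (lift y)"

lemma lift:
  assumes "x \<in> carrier G"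
  shows "lift x \<in> carrier E" "\<pi> (lift x) = x"
proof -
  have "\<exists>a. a \<in> carrier E \<and> \<pi> a = x"
    using assms unfolding surj[symmetric] by blast
  then have "lift x \<in> carrier E \<and> \<pi> (lift x) = x"
    unfolding lift_def by (rule someI_ex)
  then show "lift x \<in> carrier E" "\<pi> (lift x) = x" by auto
qed

lemma lift_image:
  assumes c: "c \<in> carrier E"
  obtains z where "z \<in> center E" "lift (\<pi> c) = z \<otimes> c"
proof
  have l: "lift (\<pi> c) \<in> carrier E" "\<pi> (lift (\<pi> c)) = \<pi> c"
    using \<pi>.hom_closed[OF c] by (rule lift)+
  have "\<pi> (lift (\<pi> c) \<otimes> inv c) = \<one>\<^bsub>G\<^esub>"
    using l c by (simp only: \<pi>.hom_mult \<pi>.hom_inv E.inv_closed G.r_inv \<pi>.hom_closed)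
  then show "lift (\<pi> c) \<otimes> inv c \<in> center E"
    using l(1) c unfolding kernel_eq[symmetric] kernel_def by blast
  show "lift (\<pi> c) = (lift (\<pi> c) \<otimes> inv c) \<otimes> c"
    using l(1) c by (simp only: E.m_assoc E.inv_closed E.l_inv E.r_one)
qed

lemma pairing_image:
  assumes a: "a \<in> carrier E" and b: "b \<in> carrier E"
  shows "pairing (\<pi> a) (\<pi> b) = commutator E a b"
proof -
  obtain z where z: "z \<in> center E" "lift (\<pi> a) = z \<otimes> a"
    by (rule lift_image[OF a])
  obtain w where w: "w \<in> center E" "lift (\<pi> b) = w \<otimes> b"
    by (rule lift_image[OF b])
  show ?thesis
    unfolding pairing_def z(2) w(2) by (rule E.commutator_center[OF a b z(1) w(1)])
qed

lemma wedge_eq_one_imp_pairing_eq_one: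
  assumes x: "x \<in> carrier G" and y: "y \<in> carrier G"
    and wedge: "wedge G x y = \<one>\<^bsub>exterior_square G\<^esub>"
  shows "pairing x y = \<one>"
proof -
  have conj: "conjugate G (\<pi> a) (\<pi> b) = \<pi> (conjugate E a b)"
    if "a \<in> carrier E" "b \<in> carrier E" for a b
    unfolding conjugate_def using that by (simp only: \<pi>.hom_mult \<pi>.hom_inv E.m_closed E.inv_closed)
  have conj_closed: "conjugate E a b \<in> carrier E" if "a \<in> carrier E" "b \<in> carrier E" for a b
    unfolding conjugate_def using that by (simp only: E.m_closed E.inv_closed)
  have lifts: "\<exists>a. a \<in> carrier E \<and> g = \<pi> a" if "g \<in> carrier G" for g
    using lift[OF that] by metis
  have closed: "pairing g h \<in> carrier E" if "g \<in> carrier G" "h \<in> carrier G" for g h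
    using that by (simp add: pairing_def lift E.commutator_closed)
  have alt: "pairing g g = \<one>" if "g \<in> carrier G" for g
    using that by (simp add: pairing_def lift E.commutator_eq_one_iff)
  have left: "pairing (g \<otimes>\<^bsub>G\<^esub> k) h = pairing (conjugate G g k) (conjugate G g h) \<otimes> pairing g h"
    if g: "g \<in> carrier G" and h: "h \<in> carrier G" and k: "k \<in> carrier G" for g h k
  proof -
    obtain a b c where abc: "a \<in> carrier E" "b \<in> carrier E" "c \<in> carrier E"
      and eq: "g = \<pi> a" "h = \<pi> b" "k = \<pi> c"
      using lifts[OF g] lifts[OF h] lifts[OF k] by blast
    have "pairing (g \<otimes>\<^bsub>G\<^esub> k) h = commutator E (a \<otimes> c) b"
      using abc pairing_image[of "a \<otimes> c" b] by (simp add: eq)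
    then show ?thesis
      using abc by (simp add: eq conj conj_closed pairing_image E.commutator_mult_left)
  qed
  have right: "pairing g (h \<otimes>\<^bsub>G\<^esub> k) = pairing g h \<otimes> pairing (conjugate G h g) (conjugate G h k)"
    if g: "g \<in> carrier G" and h: "h \<in> carrier G" and k: "k \<in> carrier G" for g h k
  proof -
    obtain a b c where abc: "a \<in> carrier E" "b \<in> carrier E" "c \<in> carrier E"
      and eq: "g = \<pi> a" "h = \<pi> b" "k = \<pi> c"
      using lifts[OF g] lifts[OF h] lifts[OF k] by blast
    have "pairing g (h \<otimes>\<^bsub>G\<^esub> k) = commutator E a (b \<otimes> c)"
      using abc pairing_image[of a "b \<otimes> c"] by (simp add: eq)
    then show ?thesis
      using abc by (simp add: eq conj conj_closed pairing_image E.commutator_mult_right)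
  qed
  show ?thesis
    by (rule E.exterior_pairing_eq_one[where K = G and b = pairing])
      (fact G.is_group closed left right alt x y wedge)+
qed

definition centralizer :: "'a \<Rightarrow> 'a set" where
  "centralizer x = {y \<in> carrier G. pairing x y = \<one>}"

lemma image_mem_centralizer_iff:
  assumes "a \<in> carrier E" "b \<in> carrier E"
  shows "\<pi> b \<in> centralizer (\<pi> a) \<longleftrightarrow> a \<otimes> b = b \<otimes> a"
  using assms by (simp add: centralizer_def pairing_image E.commutator_eq_one_iff)

lemma subgroup_centralizer:
  assumes "x \<in> carrier G"
  shows "subgroup (centralizer x) G"
proof -
  obtain a where a: "a \<in> carrier E" "x = \<pi> a"
    using lift[OF assms] by metis
  have cent: "centralizer x = \<pi> ` {b \<in> carrier E. a \<otimes> b = b \<otimes> a}"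
  proof (intro equalityI subsetI)
    fix y assume y: "y \<in> centralizer x"
    then have "y \<in> carrier G" by (simp add: centralizer_def)
    then obtain b where b: "b \<in> carrier E" "y = \<pi> b"
      using lift by metis
    then show "y \<in> \<pi> ` {b \<in> carrier E. a \<otimes> b = b \<otimes> a}"
      using y image_mem_centralizer_iff[OF a(1) b(1)] unfolding a(2) by blast
  next
    fix y assume "y \<in> \<pi> ` {b \<in> carrier E. a \<otimes> b = b \<otimes> a}"
    then show "y \<in> centralizer x"
      using image_mem_centralizer_iff[OF a(1)] unfolding a(2) by blast
  qed
  have "subgroup {b \<in> carrier E. a \<otimes> b = b \<otimes> a} E"
  proof (rule E.subgroupI)
    have "\<one> \<in> {b \<in> carrier E. a \<otimes> b = b \<otimes> a}" using a(1) by simp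
    then show "{b \<in> carrier E. a \<otimes> b = b \<otimes> a} \<noteq> {}" by blast
  next
    fix b assume "b \<in> {b \<in> carrier E. a \<otimes> b = b \<otimes> a}"
    then have b: "b \<in> carrier E" "a \<otimes> b = b \<otimes> a" by auto
    then show "inv b \<in> {b \<in> carrier E. a \<otimes> b = b \<otimes> a}"
      using E.inv_commute[OF a(1)] by blast
  next
    fix b c assume "b \<in> {b \<in> carrier E. a \<otimes> b = b \<otimes> a}" "c \<in> {b \<in> carrier E. a \<otimes> b = b \<otimes> a}"
    then show "b \<otimes> c \<in> {b \<in> carrier E. a \<otimes> b = b \<otimes> a}"
      using E.mult_commute[OF a(1)] by blast
  qed auto
  then show ?thesis
    unfolding cent by (rule \<pi>.subgroup_img_is_subgroup)
qed

lemma centralizer_refl: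
  assumes "x \<in> carrier G"
  shows "x \<in> centralizer x"
  using assms by (simp add: centralizer_def pairing_def lift E.commutator_eq_one_iff)

lemma centralizer_sym:
  assumes "x \<in> carrier G" "y \<in> centralizer x"
  shows "x \<in> centralizer y"
proof -
  have y: "y \<in> carrier G" "pairing x y = \<one>"
    using assms(2) by (simp_all add: centralizer_def)
  then have "lift x \<otimes> lift y = lift y \<otimes> lift x"
    using assms(1) by (simp add: pairing_def lift E.commutator_eq_one_iff)
  then show ?thesis
    using assms(1) y(1) by (simp add: centralizer_def pairing_def lift E.commutator_eq_one_iff)
qed

text \<open>A lift of \<open>x\<close> commutes with all of \<open>E\<close>, hence lies in the kernel of \<open>\<pi>\<close>. This is where the
  kernel has to be the full centre.\<close>

lemma centralizer_eq_carrier_imp_one: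
  assumes x: "x \<in> carrier G" and "centralizer x = carrier G"
  shows "x = \<one>\<^bsub>G\<^esub>"
proof -
  obtain a where a: "a \<in> carrier E" "x = \<pi> a"
    using lift[OF x] by metis
  have "a \<otimes> b = b \<otimes> a" if b: "b \<in> carrier E" for b
    using image_mem_centralizer_iff[OF a(1) b] \<pi>.hom_closed[OF b] assms(2) unfolding a(2) by blast
  then have "a \<in> kernel E G \<pi>"
    unfolding kernel_eq center_def using a(1) by blast
  then show ?thesis
    unfolding kernel_def a(2) by blast
qed

end

lemma capable_imp_central_cover:
  fixes G :: "('a, 'b) monoid_scheme"
  assumes G: "group G" and "capable TYPE('e) G"
  obtains E :: "'e monoid" and \<pi> where "central_cover E G \<pi>"
proof -
  interpret G: group G by fact
  obtain E :: "'e monoid" where E: "group E" and iso: "G \<cong> E Mod center E"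
    using assms(2) unfolding capable_def by blast
  interpret E: group E by fact
  interpret Z: normal "center E" E by (rule E.center_normal)
  interpret Q: group "E Mod center E" by (rule Z.factorgroup_is_group)
  obtain \<psi> where \<psi>: "\<psi> \<in> iso (E Mod center E) G"
    using G.iso_sym[OF iso] unfolding is_iso_def by blast
  then have \<psi>_hom: "\<psi> \<in> hom (E Mod center E) G"
    and \<psi>_bij: "bij_betw \<psi> (carrier (E Mod center E)) (carrier G)"
    by (auto simp: iso_def)
  interpret \<psi>: group_hom "E Mod center E" G \<psi>
    using \<psi>_hom by unfold_locales
  let ?\<pi> = "\<lambda>e. \<psi> (center E #>\<^bsub>E\<^esub> e)"
  have "?\<pi> \<in> hom E G"
    using hom_compose[OF Z.r_coset_hom_Mod \<psi>_hom] by (simp add: comp_def)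
  moreover have "?\<pi> ` carrier E = carrier G"
    using \<psi>_bij by (simp add: bij_betw_def carrier_FactGroup image_image)
  moreover have "kernel E G ?\<pi> = center E"
  proof -
    have "?\<pi> e = \<one>\<^bsub>G\<^esub> \<longleftrightarrow> e \<in> center E" if e: "e \<in> carrier E" for e
    proof -
      have "?\<pi> e = \<one>\<^bsub>G\<^esub> \<longleftrightarrow> ?\<pi> e = \<psi> (center E)"
        using \<psi>.hom_one by simp
      also have "\<dots> \<longleftrightarrow> center E #>\<^bsub>E\<^esub> e = center E"
        using \<psi>_bij e Q.one_closed by (auto simp: bij_betw_def inj_on_eq_iff carrier_FactGroup)
      also have "\<dots> \<longleftrightarrow> e \<in> center E"
        using e E.coset_join1 E.coset_join2 Z.is_subgroup Z.subset by metis
      finally show ?thesis .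
    qed
    then show ?thesis
      using E.center_subset by (auto simp: kernel_def)
  qed
  ultimately have "central_cover E G ?\<pi>"
    by unfold_locales
  then show ?thesis by (rule that)
qed

section \<open>The multiple exterior degree of a capable group\<close>

theorem theorem3p9:
  fixes G :: "('a, 'b) monoid_scheme" and p n :: nat
  assumes "group G" and "finite (carrier G)"
    and "\<not> comm_group G"
    and "capable TYPE('e) G"
    and "prime p" and "p dvd order G"
    and "\<And>q :: nat. prime q \<Longrightarrow> q dvd order G \<Longrightarrow> p \<le> q"
    and "n \<ge> 1"
  shows "exterior_degree n G \<le> 1 / real p ^ n"
proof -
  obtain E :: "'e monoid" and \<pi> where cover: "central_cover E G \<pi>"
    by (rule capable_imp_central_cover[OF assms(1,4)])
  interpret E: central_cover E G \<pi> by (rule cover)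
  interpret smallest_prime_group G p
    using assms(1,2,5-7) by (rule smallest_prime_group.intro[OF _ smallest_prime_group_axioms.intro])
  interpret commutation G p E.centralizer
    by (rule commutation.intro[OF smallest_prime_group_axioms commutation_axioms.intro])
      (fact E.subgroup_centralizer E.centralizer_refl E.centralizer_sym
        E.centralizer_eq_carrier_imp_one assms(3))+
  let ?X = "{x \<in> {1..n+1} \<rightarrow>\<^sub>E carrier G.
    \<forall>i \<in> {1..n+1}. \<forall>j \<in> {1..n+1}. wedge G (x i) (x j) = \<one>\<^bsub>exterior_square G\<^esub>}"
  have "?X \<subseteq> tuples (n + 1)"
  proof
    fix x assume "x \<in> ?X"
    then have x: "x \<in> {1..n+1} \<rightarrow>\<^sub>E carrier G"
      and wedge: "\<forall>i \<in> {1..n+1}. \<forall>j \<in> {1..n+1}. wedge G (x i) (x j) = \<one>\<^bsub>exterior_square G\<^esub>"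
      unfolding mem_Collect_eq by (rule conjunct1, rule conjunct2)
    have mem: "x i \<in> carrier G" if "i \<in> {1..n+1}" for i
      using x that by (rule PiE_mem)
    have "x j \<in> E.centralizer (x i)" if i: "i \<in> {1..n+1}" and j: "j \<in> {1..n+1}" for i j
      unfolding E.centralizer_def
      using mem[OF j] E.wedge_eq_one_imp_pairing_eq_one[OF mem[OF i] mem[OF j] wedge[rule_format, OF i j]]
      by (intro CollectI conjI)
    then show "x \<in> tuples (n + 1)"
      unfolding tuples_def using x by (intro CollectI conjI ballI)
  qed
  then have "card ?X \<le> card (tuples (n + 1))"
    using finite_tuples by (rule card_mono[rotated])
  then have "p ^ n * card ?X \<le> order G ^ (n + 1)"
    using card_tuples_le[of n] by (meson le_trans mult_le_mono2)
  then have "real (p ^ n * card ?X) \<le> real (order G ^ (n + 1))"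
    by (rule of_nat_mono)
  then have bound: "real p ^ n * real (card ?X) \<le> real (order G) ^ (n + 1)"
    by (simp only: of_nat_mult of_nat_power)
  have pos: "0 < real (order G) ^ (n + 1)" "0 < real p ^ n"
    using order_pos p_ge_2 by simp_all
  have "real (card ?X) / real (order G) ^ (n + 1) \<le> 1 / real p ^ n"
    using bound pos by (simp only: pos_divide_le_eq pos_le_divide_eq times_divide_eq_left
        mult_1_left mult.commute[of "real (card ?X)"])
  then show ?thesis
    unfolding exterior_degree_def .
qed

end
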